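(* Let $n\in\mathbb{N}$ and $0<t\leq 1$. Then $$ \begin{aligned} \sum_{k=1}^{\infty}\frac{(-t)^kH_{k-1}}{k\binom{n+k}{k}}={}&\frac{1}{2}\log^2(t+1)+\frac{t}{t+1}\sum_{k=1}^n\frac{H_k}{k}\left(\frac{t+1}{t}\right)^k\\ &-\frac{t\log(t+1)}{t+1}\sum_{k=1}^n\frac{1}{k}\left(\frac{t+1}{t}\right)^k+\frac{\log^2(t+1)}{2(t+1)}\sum_{k=1}^n\left(\frac{t+1}{t}\right)^k\\ &+\frac{1}{t+1}\sum_{p=0}^{n-1}\left\{\sum_{k=1}^{n-p}\left(\frac{H_{p+k}-H_k}{(p+k)k}+\frac{1}{k^2(p+k)}\right)\right\}p\left(\frac{t+1}{t}\right)^p\\ &-\frac{\log(t+1)}{t+1}\sum_{k=1}^nH_k\left(\frac{t+1}{t}\right)^k. \end{aligned} $$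
   Context: $\mathbb{N}=\{1,2,3,\dots\}$. $H_m=\sum_{j=1}^m \frac1j$ is the $m$-th harmonic number, with $H_0=0$. $\log^2 x$ means $(\log x)^2$. Infinite series are limits of partial sums. *)

theory Defs
  imports "HOL-Analysis.Analysis"
begin

end

theory Submission
  imports Defs
begin

text \<open>
  Write \<open>L = ln (t + 1)\<close>, \<open>x = (t + 1) / t\<close> and \<open>c n k = 1 / (k * ((n + k) choose k))\<close>.
  The weights \<open>c n k\<close> are the Beta values \<open>B(k, n + 1)\<close>, so they satisfy
  \<open>c (n+1) k = c n k - c n (k+1)\<close> and \<open>c n (k+1) / k = c (n+1) k / (n+1)\<close>.
  Multiplying by \<open>(-t)^k\<close> and summing over \<open>k\<close> turns a shift of \<open>k\<close> into a factor \<open>-1/t\<close>.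
  Hence the series \<open>h n\<close> with terms \<open>(-t)^k * c n k\<close> and the wanted series \<open>f n\<close> with
  terms \<open>(-t)^k * H (k-1) * c n k\<close> obey the first-order recurrences
  \<open>h (n+1) = x * h n + 1 / (n+1)\<close> and \<open>f (n+1) = x * f n + h (n+1) / (n+1)\<close>.
  Only termwise sums and shifts occur, so conditional convergence at \<open>t = 1\<close> is harmless.

  The initial values are \<open>h 0 = - L\<close> and \<open>f 0 = L^2 / 2\<close>. The second is the Cauchy square of
  the logarithm series for \<open>t < 1\<close>; it persists at \<open>t = 1\<close> because the partial sums of an
  alternating series enclose its value, and this enclosure passes to the limit.
  Solving the recurrences (\<open>harm_recip_binom_series\<close>) gives
  \<open>f n = x^n * L^2 / 2 - x^n * L * H n + (\<Sum>i=1..n. x^(n-i) * (H n - H (i-1)) / i)\<close>.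

  It remains to recognise the stated right-hand side. As \<open>t / (t+1) = 1 / x\<close> and
  \<open>1 / (t+1) = (x-1) / x\<close>, its coefficients of \<open>L^2\<close> and \<open>L\<close> and its remaining part are each
  a power sum multiplied by \<open>(x-1) / x\<close> plus a correction, and summation by parts matches
  them with those of the closed form (\<open>harm_power_sum_by_parts\<close>, \<open>harm_block_sum\<close>).
\<close>

section \<open>The initial series and its endpoint\<close>

text \<open>
  Abel's limit theorem in the alternating monotone case. For \<open>0 < t < 1\<close> the terms
  \<open>t^k * a k\<close> are still decreasing, so even partial sums lie below and odd ones above \<open>F t\<close>.
  Partial sums are polynomials in \<open>t\<close>, so these inequalities survive \<open>t \<rightarrow> 1\<close>, where both
  bounds converge to the sum of the series.
\<close>

lemma alternating_series_endpoint:
  fixes a :: "nat \<Rightarrow> real" and F :: "real \<Rightarrow> real"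
  assumes lim: "a \<longlonglongrightarrow> 0" and nonneg: "\<And>k. 0 \<le> a k" and dec: "\<And>k. a (Suc k) \<le> a k"
    and series: "\<And>t. 0 < t \<Longrightarrow> t < 1 \<Longrightarrow> (\<lambda>k. (- t) ^ k * a k) sums F t"
    and cont: "(F \<longlongrightarrow> F 1) (at_left 1)"
  shows "(\<lambda>k. (- 1) ^ k * a k) sums F 1"
proof -
  have ev: "eventually (\<lambda>t::real. 0 < t \<and> t < 1) (at_left 1)"
    using eventually_at_left_real[of 0 "1::real"] by simp
  have partial: "((\<lambda>t. \<Sum>i<N. (- t) ^ i * a i) \<longlongrightarrow> (\<Sum>i<N. (- 1) ^ i * a i)) (at_left 1)" for N
    by (intro tendsto_intros)
  have bounds: "(\<Sum>i<2*n. (- t) ^ i * a i) \<le> F t \<and> F t \<le> (\<Sum>i<2*n+1. (- t) ^ i * a i)"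
    if "0 < t \<and> t < 1" for t n
  proof -
    have eq: "(- t) ^ k * a k = (- 1) ^ k * (t ^ k * a k)" for k
      by (simp add: power_minus[of t] mult.assoc)
    have "(\<lambda>k. t ^ k) \<longlonglongrightarrow> 0"
      using that by (intro LIMSEQ_realpow_zero) auto
    from tendsto_mult[OF this lim] have "(\<lambda>k. t ^ k * a k) \<longlonglongrightarrow> 0" by simp
    moreover have "t ^ Suc k * a (Suc k) \<le> t ^ k * a k" for k
      using that nonneg dec by (intro mult_mono power_decreasing) auto
    ultimately show ?thesis
      using summable_Leibniz'(2,4)[of "\<lambda>k. t ^ k * a k" n] nonneg that
        sums_unique[OF series, of t] unfolding eq by auto
  qed
  have lower: "(\<Sum>i<2*n. (- 1) ^ i * a i) \<le> F 1" for n
    by (rule tendsto_le[OF trivial_limit_at_left_real cont partial])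
       (use ev bounds in \<open>auto elim!: eventually_mono\<close>)
  have upper: "F 1 \<le> (\<Sum>i<2*n+1. (- 1) ^ i * a i)" for n
    by (rule tendsto_le[OF trivial_limit_at_left_real partial cont])
       (use ev bounds in \<open>auto elim!: eventually_mono\<close>)
  note leibniz = summable_Leibniz'[OF lim nonneg dec]
  have "(\<Sum>i. (- 1) ^ i * a i) \<le> F 1"
    by (rule LIMSEQ_le_const2[OF leibniz(3)]) (use lower in auto)
  moreover have "F 1 \<le> (\<Sum>i. (- 1) ^ i * a i)"
    by (rule LIMSEQ_le_const[OF leibniz(5)]) (use upper in auto)
  ultimately show ?thesis
    using leibniz(1) by (simp add: sums_iff)
qed

lemma harm_over_n_tendsto_0: "(\<lambda>n. harm n / real n) \<longlonglongrightarrow> 0"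
proof -
  have "(\<lambda>n. (harm n - ln (real n)) * inverse (real n) + ln (real n) / real n)
          \<longlonglongrightarrow> euler_mascheroni * 0 + 0"
    by (intro tendsto_intros euler_mascheroni_LIMSEQ
          lim_inverse_n lim_ln_over_n)
  then show ?thesis by (simp add: diff_divide_distrib flip: divide_inverse)
qed

text \<open>
  By partial fractions \<open>1 / (i (k-i)) = (1/i + 1/(k-i)) / k\<close>. The terms with \<open>i = 0\<close> and
  \<open>i = k\<close> vanish by the convention \<open>1 / 0 = 0\<close>, which makes this the coefficient in the
  square of \<open>\<Sum>k. z^k / k\<close> without any shift of indices.
\<close>
lemma sum_reciprocal_products:
  "(\<Sum>i\<le>k. 1 / (real i * real (k - i))) = 2 * harm (k - 1) / real k"
proof (cases k)
  case (Suc m)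
  have "(\<Sum>i\<le>k. 1 / (real i * real (k - i))) = (\<Sum>i=1..m. 1 / (real i * real (k - i)))"
    by (rule sum.mono_neutral_right) (auto simp: Suc)
  also have "\<dots> = (\<Sum>i=1..m. inverse (real i) / real k + inverse (real (k - i)) / real k)"
  proof (rule sum.cong[OF refl])
    fix i assume "i \<in> {1..m}"
    then have pos: "real i > 0" "real (k - i) > 0" and k: "real k = real i + real (k - i)"
      by (auto simp: Suc)
    show "1 / (real i * real (k - i)) = inverse (real i) / real k + inverse (real (k - i)) / real k"
      unfolding k using pos by (simp add: divide_simps)
  qed
  also have "\<dots> = (\<Sum>i=1..m. inverse (real i)) / real k + (\<Sum>i=1..m. inverse (real (k - i))) / real k"
    by (simp add: sum.distrib sum_divide_distrib)
  also have "(\<Sum>i=1..m. inverse (real (k - i))) = (\<Sum>i=1..m. inverse (real i))"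
    by (rule sum.reindex_bij_witness[of _ "\<lambda>i. k - i" "\<lambda>i. k - i"]) (auto simp: Suc)
  finally show ?thesis by (simp add: harm_def Suc)
qed (auto simp: harm_def)

lemma ln_series_closed:
  fixes t :: real
  assumes "0 < t" "t \<le> 1"
  shows "(\<lambda>i. (- t) ^ Suc i / real (Suc i)) sums - ln (1 + t)"
proof (cases "t = 1")
  case True
  then show ?thesis
    using sums_minus[OF alternating_harmonic_series_sums] by simp
next
  case False
  then have "(\<lambda>k. - ((- t) ^ k) / real k) sums ln (1 + t)"
    using assms by (intro ln_series') auto
  from sums_minus[OF this] show ?thesis
    by (subst sums_Suc_iff) simp
qed

lemma ln_squared_series_open:
  fixes t :: real
  assumes "0 < t" "t < 1"
  shows "(\<lambda>k. (- t) ^ k * harm (k - 1) / real k) sums ((ln (1 + t))\<^sup>2 / 2)"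
proof -
  let ?a = "\<lambda>k. - ((- t) ^ k) / real k"
  have ln: "?a sums ln (1 + t)"
    using assms by (intro ln_series') auto
  have "summable (\<lambda>k. norm (?a k))"
  proof (rule summable_comparison_test')
    show "summable (\<lambda>k. t ^ k)" using assms by (intro summable_geometric) auto
    show "norm (norm (?a k)) \<le> t ^ k" if "k \<ge> 1" for k
      using that assms by (simp add: power_abs divide_le_eq mult_le_cancel_left1)
  qed
  from Cauchy_product_sums[OF this this]
  have "(\<lambda>k. \<Sum>i\<le>k. ?a i * ?a (k - i)) sums (ln (1 + t))\<^sup>2"
    using sums_unique[OF ln] by (simp add: power2_eq_square)
  also have "(\<lambda>k. \<Sum>i\<le>k. ?a i * ?a (k - i)) = (\<lambda>k. (- t) ^ k * (2 * harm (k - 1) / real k))"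
  proof
    fix k
    have "(\<Sum>i\<le>k. ?a i * ?a (k - i)) = (\<Sum>i\<le>k. (- t) ^ k * (1 / (real i * real (k - i))))"
      by (rule sum.cong) (auto simp flip: power_add)
    then show "(\<Sum>i\<le>k. ?a i * ?a (k - i)) = (- t) ^ k * (2 * harm (k - 1) / real k)"
      by (simp only: sum_distrib_left[symmetric] sum_reciprocal_products)
  qed
  finally show ?thesis
    using sums_divide[of _ _ 2] by fastforce
qed

text \<open>
  At \<open>t = 1\<close> the coefficients \<open>harm i / (i + 1)\<close> are \<open>0, 1/2, 1/2, ...\<close>, decreasing only from
  the second one on. Hence the endpoint argument is applied to the series without its zero
  term and divided by \<open>t^2\<close>.
\<close>
lemma ln_squared_series_closed:
  fixes t :: real
  assumes "0 < t" "t \<le> 1"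
  shows "(\<lambda>i. (- t) ^ Suc i * harm i / real (Suc i)) sums ((ln (1 + t))\<^sup>2 / 2)"
proof (cases "t = 1")
  case False
  then show ?thesis
    using ln_squared_series_open[of t] assms
      sums_Suc_iff[of "\<lambda>k. (- t) ^ k * harm (k - 1) / real k" "(ln (1 + t))\<^sup>2 / 2"]
    by (simp del: power_Suc of_nat_Suc)
next
  case True
  define a where "a k = harm (Suc k) / real (Suc (Suc k))" for k
  have "(\<lambda>k. (- 1) ^ k * a k) sums ((ln (1 + 1))\<^sup>2 / 2 / 1\<^sup>2)"
  proof (rule alternating_series_endpoint[where F = "\<lambda>t. (ln (1 + t))\<^sup>2 / 2 / t\<^sup>2"])
    have "(\<lambda>k. harm (Suc k) / real (Suc k) * (real (Suc k) / real (Suc (Suc k)))) \<longlonglongrightarrow> 0 * 1"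
      by (intro tendsto_mult LIMSEQ_Suc[OF harm_over_n_tendsto_0] LIMSEQ_Suc[OF LIMSEQ_n_over_Suc_n])
    then show "a \<longlonglongrightarrow> 0"
      unfolding a_def by (simp add: divide_simps del: of_nat_Suc)
    show "0 \<le> a k" for k by (simp add: a_def harm_nonneg)
    show "a (Suc k) \<le> a k" for k
    proof -
      have "harm (Suc 0) \<le> (harm (Suc k) :: real)" by (rule harm_mono) simp
      then have h: "1 \<le> (harm (Suc k) :: real)" by (simp add: harm_def)
      define m where "m = real (Suc (Suc k))"
      have m: "m > 0" and m1: "real (Suc (Suc (Suc k))) = m + 1" by (simp_all add: m_def)
      have "harm (Suc k) + inverse m \<le> harm (Suc k) * (m + 1) / m"
        using h m by (simp add: field_simps)
      then show ?thesis
        unfolding a_def harm_Suc[of "Suc k"] m1 m_def[symmetric] using m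
        by (simp add: divide_le_eq)
    qed
    show "(\<lambda>k. (- t) ^ k * a k) sums ((ln (1 + t))\<^sup>2 / 2 / t\<^sup>2)" if t: "0 < t" "t < 1" for t
    proof -
      have "(\<lambda>k. (- t) ^ Suc (Suc k) * harm (Suc k) / real (Suc (Suc k))) sums ((ln (1 + t))\<^sup>2 / 2)"
        using ln_squared_series_open[OF t]
          sums_Suc_iff[of "\<lambda>k. (- t) ^ k * harm (k - 1) / real k" "(ln (1 + t))\<^sup>2 / 2"]
          sums_Suc_iff[of "\<lambda>k. (- t) ^ Suc k * harm k / real (Suc k)" "(ln (1 + t))\<^sup>2 / 2"]
        by (simp add: harm_def[of 0] del: power_Suc of_nat_Suc)
      from sums_divide[OF this, of "t\<^sup>2"] show ?thesis
        using t by (simp add: a_def power2_eq_square)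
    qed
    show "((\<lambda>t. (ln (1 + t))\<^sup>2 / 2 / t\<^sup>2) \<longlongrightarrow> (ln (1 + 1))\<^sup>2 / 2 / 1\<^sup>2) (at_left (1::real))"
      by (intro tendsto_intros) auto
  qed
  then show ?thesis
    using sums_Suc_iff[of "\<lambda>i. (- 1) ^ Suc i * harm i / real (Suc i)" "(ln 2)\<^sup>2 / 2"]
    by (simp add: True a_def harm_def[of 0] del: of_nat_Suc)
qed

section \<open>Recurrences in n\<close>

text \<open>
  This is the Beta integral of \<open>u^(k-1) * (1-u)^n\<close> over the unit interval, for \<open>k \<ge> 1\<close>.
\<close>
definition recip_binom :: "nat \<Rightarrow> nat \<Rightarrow> real" where
  "recip_binom n k = 1 / (real k * real ((n + k) choose k))"

text \<open>
  Under the Beta integral the first relation is \<open>(1-u)^(n+1) = (1-u)^n - u * (1-u)^n\<close> and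
  the second is integration by parts. Here both follow from expressing the two neighbouring
  binomial coefficients through \<open>(n + k) choose k\<close>.
\<close>
lemma
  assumes "k \<ge> 1"
  shows recip_binom_Suc_left: "recip_binom (Suc n) k = recip_binom n k - recip_binom n (Suc k)"
    and recip_binom_Suc_right: "recip_binom n (Suc k) / real k = recip_binom (Suc n) k / real (Suc n)"
proof -
  define C where "C = real ((n + k) choose k)"
  have C: "C > 0" by (simp add: C_def)
  have "Suc k * (Suc (n + k) choose Suc k) = Suc (n + k) * ((n + k) choose k)"
    using Suc_times_binomial_eq[of "n + k" k] by (simp only: mult.commute)
  then have "real (Suc k) * real (Suc (n + k) choose Suc k) = real (Suc (n + k)) * C"
    unfolding C_def of_nat_mult[symmetric] by (rule arg_cong)
  then have r: "recip_binom n (Suc k) = 1 / (real (Suc (n + k)) * C)"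
    by (simp add: recip_binom_def)
  have "Suc n * (Suc (n + k) choose k) = Suc (n + k) * ((n + k) choose k)"
    using binomial_absorb_comp[of "Suc (n + k)" k] by simp
  then have "real (Suc n) * real (Suc (n + k) choose k) = real (Suc (n + k)) * C"
    unfolding C_def of_nat_mult[symmetric] by (rule arg_cong)
  then have "real (Suc (n + k) choose k) = real (Suc (n + k)) * C / real (Suc n)"
    by (simp add: field_simps)
  then have l: "recip_binom (Suc n) k = real (Suc n) / (real k * (real (Suc (n + k)) * C))"
    by (simp add: recip_binom_def)
  have b: "recip_binom n k = 1 / (real k * C)"
    by (simp add: recip_binom_def C_def)
  show "recip_binom (Suc n) k = recip_binom n k - recip_binom n (Suc k)"
    unfolding l r b using assms C by (simp add: divide_simps)
  show "recip_binom n (Suc k) / real k = recip_binom (Suc n) k / real (Suc n)"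
    unfolding l r using assms C by (simp del: of_nat_Suc)
qed

text \<open>
  With \<open>h n\<close> the sum, the first recurrence of the weights gives
  \<open>h (n+1) = h n + (h n + t / (n+1)) / t\<close>: the shifted series lacks its first term
  \<open>- t / (n+1)\<close>.
\<close>
lemma recip_binom_series:
  fixes t :: real
  assumes "0 < t" "t \<le> 1"
  defines "x \<equiv> (t + 1) / t"
  shows "(\<lambda>i. (- t) ^ Suc i * recip_binom n (Suc i)) sums
           ((\<Sum>i=1..n. x ^ (n - i) / real i) - x ^ n * ln (t + 1))"
proof (induction n)
  case 0
  then show ?case
    using ln_series_closed[OF assms(1,2)] by (simp add: recip_binom_def add.commute)
next
  case (Suc n)
  let ?h = "\<lambda>n i. (- t) ^ Suc i * recip_binom n (Suc i)"
  let ?S = "\<lambda>n. (\<Sum>i=1..n. x ^ (n - i) / real i) - x ^ n * ln (t + 1)"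
  have h0: "?h n 0 = - t / real (Suc n)"
    by (simp add: recip_binom_def)
  have "(\<lambda>i. ?h n (Suc i)) sums (?S n - ?h n 0)"
    using Suc by (subst sums_Suc_iff) simp
  from sums_add[OF Suc sums_divide[OF this, of t]]
  have "(\<lambda>i. ?h n i + ?h n (Suc i) / t) sums (?S n + (?S n - ?h n 0) / t)" .
  moreover have "?h n i + ?h n (Suc i) / t = ?h (Suc n) i" for i
    using assms(1) by (simp add: recip_binom_Suc_left right_diff_distrib)
  moreover have "?S n + (?S n - ?h n 0) / t = ?S (Suc n)"
  proof -
    have "(?S n - ?h n 0) / t = ?S n / t + 1 / real (Suc n)"
      unfolding h0 using assms(1) by (simp add: diff_divide_distrib add_divide_distrib del: of_nat_Suc)
    moreover have "x * r = r + r / t" for r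
      using assms(1) by (simp add: x_def field_simps)
    ultimately have "?S n + (?S n - ?h n 0) / t = x * ?S n + 1 / real (Suc n)"
      by (simp only: add.assoc)
    also have "\<dots> = ?S (Suc n)"
      by (simp add: sum_distrib_left Suc_diff_le algebra_simps)
    finally show ?thesis .
  qed
  ultimately show ?case by simp
qed

text \<open>
  Shifting \<open>k\<close> replaces \<open>harm (k-1)\<close> by \<open>harm k = harm (k-1) + 1/k\<close>. The extra \<open>1/k\<close> is
  absorbed by the second recurrence of the weights and produces the series of
  \<open>recip_binom_series\<close> for \<open>n + 1\<close>. The first term of the series is zero, so the shift itself
  costs nothing.
\<close>
lemma harm_recip_binom_series:
  fixes t :: real
  assumes "0 < t" "t \<le> 1"
  defines "x \<equiv> (t + 1) / t"
  shows "(\<lambda>i. (- t) ^ Suc i * harm i * recip_binom n (Suc i)) sums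
           (x ^ n * (ln (t + 1))\<^sup>2 / 2 - x ^ n * ln (t + 1) * harm n
            + (\<Sum>i=1..n. x ^ (n - i) * (harm n - harm (i - 1)) / real i))"
proof (induction n)
  case 0
  then show ?case
    using ln_squared_series_closed[OF assms(1,2)] by (simp add: recip_binom_def add.commute harm_def)
next
  case (Suc n)
  let ?h = "\<lambda>n i. (- t) ^ Suc i * recip_binom n (Suc i)"
  let ?G = "\<lambda>n. (\<Sum>i=1..n. x ^ (n - i) / real i) - x ^ n * ln (t + 1)"
  let ?f = "\<lambda>n i. (- t) ^ Suc i * harm i * recip_binom n (Suc i)"
  let ?T = "\<lambda>n. \<Sum>i=1..n. x ^ (n - i) * (harm n - harm (i - 1)) / real i"
  let ?F = "\<lambda>n. x ^ n * (ln (t + 1))\<^sup>2 / 2 - x ^ n * ln (t + 1) * harm n + ?T n"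
  have "(\<lambda>i. ?f n (Suc i)) sums ?F n"
    using Suc by (subst sums_Suc_iff) (simp add: harm_def)
  from sums_add[OF sums_add[OF Suc sums_divide[OF this, of t]]
      sums_divide[OF recip_binom_series[OF assms(1,2), of "Suc n"], of "real (Suc n)"]]
  have "(\<lambda>i. ?f n i + ?f n (Suc i) / t + ?h (Suc n) i / real (Suc n)) sums
          (?F n + ?F n / t + ?G (Suc n) / real (Suc n))"
    unfolding x_def .
  moreover have "?f n i + ?f n (Suc i) / t + ?h (Suc n) i / real (Suc n) = ?f (Suc n) i" for i
  proof -
    define r where "r = recip_binom n (Suc (Suc i))"
    have "?h (Suc n) i / real (Suc n) = (- t) ^ Suc i * (r / real (Suc i))"
      using recip_binom_Suc_right[of "Suc i" n] by (simp add: r_def)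
    moreover have "harm (Suc i) * r = harm i * r + r / real (Suc i)"
      by (simp add: harm_Suc distrib_right divide_inverse)
    then have "?f n (Suc i) / t = - ((- t) ^ Suc i * (harm i * r + r / real (Suc i)))"
      using assms(1) by (simp add: r_def)
    ultimately show ?thesis
      by (simp add: recip_binom_Suc_left r_def[symmetric] algebra_simps del: power_Suc of_nat_Suc)
  qed
  moreover have "?F n + ?F n / t + ?G (Suc n) / real (Suc n) = ?F (Suc n)"
  proof -
    have T: "?T (Suc n) = x * ?T n + (\<Sum>i=1..Suc n. x ^ (Suc n - i) / real i) / real (Suc n)"
    proof -
      have "?T (Suc n) = (\<Sum>i=1..Suc n. x ^ (Suc n - i) * (harm n - harm (i - 1)) / real i
                           + x ^ (Suc n - i) / real i / real (Suc n))"
        by (rule sum.cong) (auto simp: harm_Suc divide_inverse algebra_simps)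
      also have "\<dots> = (\<Sum>i=1..Suc n. x ^ (Suc n - i) * (harm n - harm (i - 1)) / real i)
                     + (\<Sum>i=1..Suc n. x ^ (Suc n - i) / real i) / real (Suc n)"
        by (simp only: sum.distrib sum_divide_distrib)
      also have "(\<Sum>i=1..Suc n. x ^ (Suc n - i) * (harm n - harm (i - 1)) / real i) = x * ?T n"
        by (simp add: sum_distrib_left Suc_diff_le mult.assoc)
      finally show ?thesis .
    qed
    have arith: "x * (X * A / 2 - X * L * h + D) + (W - x * X * L) / m
        = x * X * A / 2 - x * X * L * (h + inverse m) + (x * D + W / m)" for X A L h D W m :: real
      by (simp add: algebra_simps diff_divide_distrib inverse_eq_divide)
    have "r + r / t = x * r" for r
      using assms(1) by (simp add: x_def field_simps)
    from this[of "?F n"] show ?thesis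
      unfolding T unfolding harm_Suc power_Suc by (simp only:) (rule arith)
  qed
  ultimately show ?case by simp
qed

section \<open>Rearranging the closed form\<close>

text \<open>
  For the coefficient of \<open>L\<close>: since \<open>1/k\<close> is the difference of consecutive harmonic numbers, the
  left-hand side telescopes.
\<close>
lemma harm_power_sum_by_parts:
  fixes x :: real
  shows "(x - 1) * (\<Sum>k=1..n. harm k * x ^ k) + (\<Sum>k=1..n. 1 / real k * x ^ k) = x * x ^ n * harm n"
proof (induction n)
  case (Suc n)
  define y where "y = 1 / real (Suc n)"
  have "harm (Suc n) = harm n + y" by (simp add: harm_Suc y_def divide_inverse)
  with Suc show ?case by (simp add: algebra_simps) (simp add: y_def)
qed (simp add: harm_def)

lemma power_sum_by_parts:
  fixes x :: real
  shows "(x - 1) * (\<Sum>p<n. b p * x ^ p) = (\<Sum>p<n. (b p - b (Suc p)) * x ^ Suc p) + b n * x ^ n - b 0"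
  by (induction n) (simp_all add: field_simps)

text \<open>
  With \<open>m = n - p\<close> this is the coefficient of \<open>x^p\<close> in the double sum of the theorem. Making
  \<open>m\<close> independent of \<open>p\<close> lets one induct on \<open>m\<close> with \<open>p\<close> fixed.
\<close>
definition harm_block :: "nat \<Rightarrow> nat \<Rightarrow> real" where
  "harm_block p m = (\<Sum>k=1..m. (harm (p + k) - harm k) / (real (p + k) * real k)
                                + 1 / ((real k)\<^sup>2 * real (p + k))) * real p"

text \<open>
  The two fractions of a summand combine to \<open>(harm (p+k) - harm (k-1)) / ((p+k) * k)\<close>, and
  \<open>p / ((p+k) * k) = 1/k - 1/(p+k)\<close>.
\<close>
lemma harm_block_Suc:
  "harm_block p (Suc m) = harm_block p m +
     (harm (p + Suc m) - harm m) * (1 / real (Suc m) - 1 / real (p + Suc m))"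
proof -
  have "((harm (p + Suc m) - harm (Suc m)) / (real (p + Suc m) * real (Suc m))
          + 1 / ((real (Suc m))\<^sup>2 * real (p + Suc m))) * real p
        = (harm (p + Suc m) - harm m) * (1 / real (Suc m) - 1 / real (p + Suc m))"
  proof -
    define a where "a = real (Suc m)"
    define b where "b = real (p + Suc m)"
    have "a > 0" "b > 0" and p: "real p = b - a" by (simp_all add: a_def b_def)
    then show ?thesis
      unfolding harm_Suc[of m] a_def[symmetric] b_def[symmetric] p
      by (simp add: field_simps power2_eq_square)
  qed
  then show ?thesis
    by (simp add: harm_block_def distrib_right del: of_nat_Suc of_nat_add)
qed

text \<open>
  This compares the coefficients of \<open>x^(p+1)\<close> in \<open>harm_block_sum\<close>, with \<open>n = p + m + 1\<close>:
  multiplication by \<open>x - 1\<close> subtracts from a coefficient its successor, whose \<open>p\<close> is larger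
  and whose \<open>m\<close> is smaller by one.
\<close>
lemma harm_block_diff:
  "harm_block p (Suc m) - harm_block (Suc p) m + harm (Suc p) / real (Suc p)
     = (harm (Suc (p + m)) - harm m) / real (Suc m)"
proof (induction m)
  case 0
  then show ?case
    unfolding harm_block_Suc
    by (simp add: harm_block_def harm_def[of 0] right_diff_distrib del: of_nat_Suc)
next
  case (Suc m)
  \<comment> \<open>In these variables the induction step is an identity of polynomials.\<close>
  define u where "u = 1 / real (Suc m)"
  define v where "v = 1 / real (Suc (Suc m))"
  define w where "w = 1 / real (Suc (Suc (p + m)))"
  define g where "g = (harm m :: real)"
  define h where "h = (harm (Suc (p + m)) :: real)"
  have H: "harm (Suc m) = g + u" "harm (Suc (Suc (p + m))) = h + w"
    by (simp_all add: harm_Suc[of m] harm_Suc[of "Suc (p + m)"] g_def h_def u_def w_def divide_inverse)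
  have "harm_block p (Suc (Suc m)) = harm_block p (Suc m) + (h + w - (g + u)) * (v - w)"
    using harm_block_Suc[of p "Suc m"] by (simp add: H v_def w_def)
  moreover have "harm_block (Suc p) (Suc m) = harm_block (Suc p) m + (h + w - g) * (u - w)"
    using harm_block_Suc[of "Suc p" m] by (simp add: H u_def w_def g_def)
  moreover have "harm_block p (Suc m) - harm_block (Suc p) m + harm (Suc p) / real (Suc p) = (h - g) * u"
    using Suc by (simp add: h_def g_def u_def)
  moreover have "(harm (Suc (p + Suc m)) - harm (Suc m)) / real (Suc (Suc m)) = (h + w - (g + u)) * v"
    by (simp add: H v_def)
  ultimately show ?case
    by (simp only:) (simp add: algebra_simps)
qed

text \<open>
  The part of the closed form without \<open>L\<close>. Summation by parts has no boundary terms, because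
  \<open>harm_block p 0\<close> and \<open>harm_block 0 m\<close> are both zero.
\<close>
lemma harm_block_sum:
  fixes x :: real
  shows "(\<Sum>k=1..n. harm k / real k * x ^ k) + (x - 1) * (\<Sum>p<n. harm_block p (n - p) * x ^ p)
     = x * (\<Sum>i=1..n. x ^ (n - i) * (harm n - harm (i - 1)) / real i)"
proof -
  have "(\<Sum>k=1..n. harm k / real k * x ^ k) = (\<Sum>p<n. harm (Suc p) / real (Suc p) * x ^ Suc p)"
    by (rule sum.reindex_bij_witness[of _ Suc "\<lambda>k. k - 1"]) auto
  moreover have "(x - 1) * (\<Sum>p<n. harm_block p (n - p) * x ^ p)
      = (\<Sum>p<n. (harm_block p (n - p) - harm_block (Suc p) (n - Suc p)) * x ^ Suc p)"
    using power_sum_by_parts[of x "\<lambda>p. harm_block p (n - p)" n] by (simp add: harm_block_def)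
  ultimately have "(\<Sum>k=1..n. harm k / real k * x ^ k) + (x - 1) * (\<Sum>p<n. harm_block p (n - p) * x ^ p)
      = (\<Sum>p<n. (harm_block p (n - p) - harm_block (Suc p) (n - Suc p)
                  + harm (Suc p) / real (Suc p)) * x ^ Suc p)"
    by (simp add: sum.distrib[symmetric] distrib_right add.commute)
  also have "\<dots> = (\<Sum>p<n. (harm n - harm (n - Suc p)) / real (n - p) * x ^ Suc p)"
  proof (rule sum.cong[OF refl])
    fix p assume "p \<in> {..<n}"
    then have eq: "n - p = Suc (n - Suc p)" "Suc (p + (n - Suc p)) = n" by auto
    show "(harm_block p (n - p) - harm_block (Suc p) (n - Suc p) + harm (Suc p) / real (Suc p)) * x ^ Suc p
        = (harm n - harm (n - Suc p)) / real (n - p) * x ^ Suc p"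
      using harm_block_diff[of p "n - Suc p"] unfolding eq by simp
  qed
  also have "\<dots> = (\<Sum>i=1..n. x * (x ^ (n - i) * (harm n - harm (i - 1)) / real i))"
    by (rule sum.reindex_bij_witness[of _ "\<lambda>i. n - i" "\<lambda>p. n - p"]) auto
  finally show ?thesis by (simp add: sum_distrib_left)
qed

theorem theorem2p15:
  fixes n :: nat and t :: real
  assumes "n \<ge> 1" and "0 < t" and "t \<le> 1"
  shows "(\<lambda>i. let k = Suc i in
            (- t) ^ k * harm (k - 1) / (real k * real ((n + k) choose k)))
         sums
          (1 / 2 * (ln (t + 1))\<^sup>2
           + t / (t + 1) * (\<Sum>k = 1..n. harm k / real k * ((t + 1) / t) ^ k)
           - t * ln (t + 1) / (t + 1) * (\<Sum>k = 1..n. 1 / real k * ((t + 1) / t) ^ k)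
           + (ln (t + 1))\<^sup>2 / (2 * (t + 1)) * (\<Sum>k = 1..n. ((t + 1) / t) ^ k)
           + 1 / (t + 1) *
               (\<Sum>p = 0..n - 1.
                  (\<Sum>k = 1..n - p.
                     (harm (p + k) - harm k) / (real (p + k) * real k)
                     + 1 / ((real k)\<^sup>2 * real (p + k)))
                  * real p * ((t + 1) / t) ^ p)
           - ln (t + 1) / (t + 1) * (\<Sum>k = 1..n. harm k * ((t + 1) / t) ^ k))"
proof -
  define x where "x = (t + 1) / t"
  define L where "L = ln (t + 1)"
  define D where "D = (\<Sum>i=1..n. x ^ (n - i) * (harm n - harm (i - 1)) / real i)"
  define P where "P = (\<Sum>k=1..n. x ^ k)"
  define Q where "Q = (\<Sum>k=1..n. 1 / real k * x ^ k)"
  define R where "R = (\<Sum>k=1..n. harm k * x ^ k)"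
  define U where "U = (\<Sum>k=1..n. harm k / real k * x ^ k)"
  define V where "V = (\<Sum>p<n. harm_block p (n - p) * x ^ p)"
  have x: "x > 1" using assms by (simp add: x_def field_simps)
  have coeff: "t / (t + 1) = 1 / x" "1 / (t + 1) = (x - 1) / x"
    using assms by (simp_all add: x_def field_simps)
  have geometric: "(x - 1) * P = x * (x ^ n - 1)"
    unfolding P_def by (induction n) (simp_all add: field_simps)
  have by_parts: "(x - 1) * R + Q = x * x ^ n * harm n"
    unfolding R_def Q_def by (rule harm_power_sum_by_parts)
  have blocks: "U + (x - 1) * V = x * D"
    unfolding U_def V_def D_def by (rule harm_block_sum)
  have V: "(\<Sum>p = 0..n - 1. (\<Sum>k = 1..n - p. (harm (p + k) - harm k) / (real (p + k) * real k)
             + 1 / ((real k)\<^sup>2 * real (p + k))) * real p * x ^ p) = V"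
    unfolding V_def harm_block_def using assms(1) by (intro sum.cong) auto
  have "x ^ n * L\<^sup>2 / 2 - x ^ n * L * harm n + D
      = 1 / 2 * L\<^sup>2 + L\<^sup>2 / 2 * ((x - 1) * P / x) - L * (((x - 1) * R + Q) / x) + (U + (x - 1) * V) / x"
    unfolding geometric by_parts blocks using x by (simp add: field_simps)
  also have "\<dots> = 1 / 2 * L\<^sup>2 + 1 / x * U - L * (1 / x) * Q + L\<^sup>2 / 2 * ((x - 1) / x) * P
      + (x - 1) / x * V - L * ((x - 1) / x) * R"
    using x by (simp add: field_simps)
  also have "\<dots> = 1 / 2 * L\<^sup>2 + t / (t + 1) * U - t * L / (t + 1) * Q + L\<^sup>2 / (2 * (t + 1)) * P
      + 1 / (t + 1) * V - L / (t + 1) * R"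
    unfolding coeff[symmetric] by (simp add: mult.commute)
  finally have closed: "x ^ n * L\<^sup>2 / 2 - x ^ n * L * harm n + D = \<dots>" .
  have "(\<lambda>i. (- t) ^ Suc i * harm i * recip_binom n (Suc i)) sums
          (x ^ n * L\<^sup>2 / 2 - x ^ n * L * harm n + D)"
    unfolding x_def L_def D_def by (rule harm_recip_binom_series[OF assms(2,3)])
  then show ?thesis
    unfolding closed unfolding V[symmetric] P_def Q_def R_def U_def
    by (simp add: recip_binom_def Let_def flip: x_def L_def)
qed

end
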